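(* Let $n=3$, so that $X=\{x\in\mathbb{R}^3:\|x\|_\infty=1\}$. Let $A=(1,a,b)\in X$ and $B=(-1,c,d)\in X$. Then the geodesic distance between $A$ and $B$ is equal to the minimum of the following twelve numbers $s_1,\dots,s_{12}$: \[s_1=4-a-c,\quad s_2=4+a+c,\quad s_3=4-b-d,\quad s_4=4+b+d,\] \[s_5=\max\{2-a-d,\ 4-b-c\},\quad s_6=\max\{2-a+d,\ 4+b-c\},\] \[s_7=\max\{2+a-d,\ 4-b+c\},\quad s_8=\max\{2+a+d,\ 4+b+c\},\] \[s_9=\max\{2-b-c,\ 4-a-d\},\quad s_{10}=\max\{2+b-c,\ 4-a+d\},\] \[s_{11}=\max\{2-b+c,\ 4+a-d\},\quad s_{12}=\max\{2+b+c,\ 4+a+d\}.\] The minimum is $s_1$ if and only if at least one of the following conditions is satisfied: (i) $|b|\le a$ and $|d|\le c$; (ii) $c=-d=1$ and $b\ge -a$; (iii) $c=d=1$ and $b\le a$; (iv) $a=-b=1$ and $d\ge -c$; (v) $a=b=1$ and $d\le c$. The minimum is $s_6$ if and only if at least one of the following conditions is satisfied: (i') $a+b\le 0$ and $c+d\ge 0$ and $|a+d|\le c-b$ and $b+d\le a+c$ and $b\le 0$ and $c\ge 0$; (ii') $b=-1$ and $c\ge 0$ and $-c\le d\le 1+a+c$; (iii') $b=-1$ and $d\ge 1-a-c$; (iv') $c=1$ and $b\le 0$ and $b+d-1\le a\le -b$; (v') $c=1$ and $a\le -1-b-d$.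
   Context: Let $X=\{x\in\mathbb{R}^n:\|x\|_\infty=1\}$ be the unit sphere of $\mathbb{R}^n$ with the sup norm $\|x\|_\infty=\max_i|x_i|$. The geodesic distance between $A,B\in X$ is the one induced by the sup norm: the shortest arc length (measured with $\|\cdot\|_\infty$) among all curves lying on $X$ that join $A$ and $B$. Convention: only paths whose nonvoid intersection with each $(n-1)$-dimensional face ($\{x\in X:x_i=1\}$ or $\{x\in X:x_i=-1\}$) is a line segment are considered, so every path from $A$ to $B$ is a finite sequence of line segments $AC_1,C_1C_2,\dots,C_mB$, where each $C_i$ lies in an $(n-2)$-dimensional face of $X$. "The minimum is $s_i$" means $\min\{s_1,\dots,s_{12}\}=s_i$ (ties allowed). *)

theory Defs
  imports "HOL-Analysis.Analysis"
begin

definition sup_sphere :: "(real ^ 'n) set" where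
  "sup_sphere = {x. infnorm x = 1}"

definition sphere_faces :: "(real ^ 'n) set set" where
  "sphere_faces = {{x \<in> sup_sphere. x $ i = \<sigma>} | i \<sigma>. \<sigma> = 1 \<or> \<sigma> = - 1}"

text \<open>
  Arc length with respect to the sup norm: the supremum of the lengths of all polygons inscribed
  in the curve. It is infinite for non-rectifiable curves.
\<close>

definition sup_arc_length :: "(real \<Rightarrow> real ^ 'n) \<Rightarrow> ereal" where
  "sup_arc_length g =
     (SUP (m, t) \<in> {(m :: nat, t :: nat \<Rightarrow> real). mono_on {..m} t \<and> t ` {..m} \<subseteq> {0..1}}.
        ereal (\<Sum>i<m. infnorm (g (t (Suc i)) - g (t i))))"

text \<open>
  The segment in which a path meets a face may degenerate to a point (\<open>P = Q\<close>); this
  cannot be excluded, since a path may enter a face and leave it at one and the same point.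
\<close>

definition admissible_path ::
    "real ^ 'n \<Rightarrow> real ^ 'n \<Rightarrow> (real \<Rightarrow> real ^ 'n) \<Rightarrow> bool" where
  "admissible_path A B g \<longleftrightarrow>
     path g \<and> path_image g \<subseteq> sup_sphere \<and> pathstart g = A \<and> pathfinish g = B \<and>
     (\<forall>F \<in> sphere_faces. path_image g \<inter> F \<noteq> {} \<longrightarrow>
        (\<exists>P Q. path_image g \<inter> F = closed_segment P Q))"

text \<open>
  The geodesic distance is a minimum, not merely an infimum, so it is introduced as a relation
  that includes the existence of a shortest path.
\<close>

definition has_geodesic_distance :: "real ^ 'n \<Rightarrow> real ^ 'n \<Rightarrow> real \<Rightarrow> bool" where
  "has_geodesic_distance A B l \<longleftrightarrow>
     (\<exists>g. admissible_path A B g \<and> sup_arc_length g = ereal l) \<and>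
     (\<forall>g. admissible_path A B g \<longrightarrow> ereal l \<le> sup_arc_length g)"

end

theory Submission
  imports Defs
begin

text \<open>
  Coordinates are written \<open>(x, y, z)\<close>; \<open>A\<close> lies in the face \<open>x = 1\<close> and \<open>B\<close> in the opposite face
  \<open>x = - 1\<close>. A path from \<open>A\<close> to \<open>B\<close> crosses some of the four side faces \<open>y = 1\<close>, \<open>y = - 1\<close>, \<open>z = 1\<close>,
  \<open>z = - 1\<close>. Unfolding the faces along the way into a plane turns the sup-norm length of a straight
  line into the larger of its two coordinate displacements. The numbers \<open>s 1, \<dots>, s 4\<close> belong to the
  routes across one side face and \<open>s 5, \<dots>, s 12\<close> to those across two adjacent ones.

  Lower bound. The function \<open>unfolded_dist a b\<close> is given on each face by a minimum of unfolded
  distances from \<open>A\<close>. These formulas agree on the edges of the cube, and each of them is 1-Lipschitz in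
  the sup norm. By \<open>potential_le_sup_arc_length\<close> such a function grows along any curve on the sphere
  by at most the length of the curve. As it is \<open>0\<close> at \<open>A\<close> and the minimum of the twelve numbers at
  \<open>B\<close>, no curve on the sphere, admissible or not, is shorter than this minimum.

  Upper bound. It remains to realise the minimum by an admissible broken line. Reflecting and
  swapping the coordinates \<open>y\<close> and \<open>z\<close> reduces this to \<open>s 1\<close> and \<open>s 6\<close>. If \<open>s 1\<close> is minimal, the route
  across \<open>y = 1\<close> with constant \<open>z\<close> in the first and the last face works (\<open>joined_within_one_face\<close>). If
  \<open>s 6\<close> is minimal, comparison with \<open>s 1\<close> and \<open>s 4\<close> gives \<open>a + b \<le> 0\<close> and \<open>c + d \<ge> 0\<close>, and this is
  enough for the straight line of the unfolding to stay within the unfolded faces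
  (\<open>joined_within_two_faces\<close>).

  The two characterisations of the minimum are statements of linear real arithmetic.
\<close>

section \<open>The unit sphere of the sup norm and its faces\<close>

lemma infnorm_le_iff: "infnorm (x :: real ^ 'n) \<le> r \<longleftrightarrow> (\<forall>i. \<bar>x $ i\<bar> \<le> r)"
proof -
  have "infnorm x = Max (range (\<lambda>i. \<bar>x $ i\<bar>))"
    by (simp add: infnorm_cart cSup_eq_Max full_SetCompr_eq)
  then show ?thesis by simp
qed

lemma infnorm_attained: "\<exists>i. infnorm (x :: real ^ 'n) = \<bar>x $ i\<bar>"
proof -
  have "infnorm x = Max (range (\<lambda>i. \<bar>x $ i\<bar>))"
    by (simp add: infnorm_cart cSup_eq_Max full_SetCompr_eq)
  then show ?thesis
    using Max_in[of "range (\<lambda>i. \<bar>x $ i\<bar>)"] by (simp add: image_iff)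
qed

lemma infnorm_3: "infnorm (x :: real ^ 3) = max \<bar>x $ 1\<bar> (max \<bar>x $ 2\<bar> \<bar>x $ 3\<bar>)"
proof (rule antisym)
  show "infnorm x \<le> max \<bar>x $ 1\<bar> (max \<bar>x $ 2\<bar> \<bar>x $ 3\<bar>)"
    by (auto simp: infnorm_le_iff forall_3 le_max_iff_disj)
  show "max \<bar>x $ 1\<bar> (max \<bar>x $ 2\<bar> \<bar>x $ 3\<bar>) \<le> infnorm x"
    by (simp add: component_le_infnorm_cart)
qed

lemma mem_sup_sphere_iff:
  "(x :: real ^ 'n) \<in> sup_sphere \<longleftrightarrow> (\<forall>i. \<bar>x $ i\<bar> \<le> 1) \<and> (\<exists>i. \<bar>x $ i\<bar> = 1)"
proof
  assume "x \<in> sup_sphere"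
  then have 1: "infnorm x = 1" by (simp add: sup_sphere_def)
  then show "(\<forall>i. \<bar>x $ i\<bar> \<le> 1) \<and> (\<exists>i. \<bar>x $ i\<bar> = 1)"
    using infnorm_le_iff[of x 1] infnorm_attained[of x] by auto
next
  assume R: "(\<forall>i. \<bar>x $ i\<bar> \<le> 1) \<and> (\<exists>i. \<bar>x $ i\<bar> = 1)"
  then obtain i where "\<bar>x $ i\<bar> = 1" by blast
  then have "1 \<le> infnorm x" using component_le_infnorm_cart[of x i] by simp
  moreover have "infnorm x \<le> 1" using R by (simp add: infnorm_le_iff)
  ultimately show "x \<in> sup_sphere" by (simp add: sup_sphere_def)
qed

lemma sup_sphere_3:
  "vector [x, y, z] \<in> (sup_sphere :: (real ^ 3) set) \<longleftrightarrow>
     \<bar>x\<bar> \<le> 1 \<and> \<bar>y\<bar> \<le> 1 \<and> \<bar>z\<bar> \<le> 1 \<and> (\<bar>x\<bar> = 1 \<or> \<bar>y\<bar> = 1 \<or> \<bar>z\<bar> = 1)"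
proof -
  have "(\<exists>i :: 3. P i) \<longleftrightarrow> P 1 \<or> P 2 \<or> P 3" for P
    by (metis exhaust_3)
  then show ?thesis by (simp add: mem_sup_sphere_iff forall_3)
qed

lemma sphere_facesE:
  fixes F :: "(real ^ 'n) set"
  assumes "F \<in> sphere_faces"
  obtains i \<sigma> where "\<bar>\<sigma>\<bar> = 1" and "F = {x \<in> sup_sphere. x $ i = \<sigma>}"
proof -
  from assms obtain i \<sigma> where "\<sigma> = 1 \<or> \<sigma> = - 1" and F: "F = {x \<in> sup_sphere. x $ i = \<sigma>}"
    unfolding sphere_faces_def by blast
  then have "\<bar>\<sigma>\<bar> = 1" by auto
  with F show thesis by (rule that[rotated])
qed

lemma face_eq:
  assumes "\<bar>\<sigma>\<bar> = (1 :: real)"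
  shows "{x \<in> sup_sphere. x $ i = \<sigma>} = cbox (- 1) (1 :: real ^ 'n) \<inter> {x. axis i 1 \<bullet> x = \<sigma>}"
  using assms by (auto simp: mem_sup_sphere_iff mem_box_cart inner_axis' abs_le_iff minus_le_iff)

lemma
  fixes F :: "(real ^ 'n) set"
  assumes "F \<in> sphere_faces"
  shows convex_face: "convex F" and closed_face: "closed F"
proof -
  from assms obtain i \<sigma> where "\<bar>\<sigma>\<bar> = 1" and "F = {x \<in> sup_sphere. x $ i = \<sigma>}"
    by (rule sphere_facesE)
  then have F: "F = cbox (- 1) 1 \<inter> {x. axis i 1 \<bullet> x = \<sigma>}" by (simp only: face_eq)
  show "convex F" unfolding F by (intro convex_Int convex_box convex_hyperplane)
  show "closed F" unfolding F by (intro closed_Int closed_cbox closed_hyperplane)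
qed

lemma finite_sphere_faces: "finite (sphere_faces :: (real ^ 'n) set set)"
proof (rule finite_subset)
  show "sphere_faces \<subseteq> (\<Union>i. {{x :: real ^ 'n. x \<in> sup_sphere \<and> x $ i = 1},
                             {x. x \<in> sup_sphere \<and> x $ i = - 1}})"
    by (auto simp: sphere_faces_def)
qed simp

lemma Union_sphere_faces: "\<Union> sphere_faces = (sup_sphere :: (real ^ 'n) set)"
proof
  show "\<Union> sphere_faces \<subseteq> (sup_sphere :: (real ^ 'n) set)"
    by (auto simp: sphere_faces_def)
  show "(sup_sphere :: (real ^ 'n) set) \<subseteq> \<Union> sphere_faces"
  proof
    fix x :: "real ^ 'n" assume x: "x \<in> sup_sphere"
    then obtain i where "\<bar>x $ i\<bar> = 1" by (auto simp: mem_sup_sphere_iff)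
    then have "x $ i = 1 \<or> x $ i = - 1" by linarith
    with x show "x \<in> \<Union> sphere_faces" unfolding sphere_faces_def by blast
  qed
qed

lemma vector_3_eq_iff:
  "(vector [x, y, z] :: 'a :: zero ^ 3) = vector [x', y', z'] \<longleftrightarrow> x = x' \<and> y = y' \<and> z = z'"
  by (auto simp: vec_eq_iff forall_3)

lemma infnorm_vector_diff:
  "infnorm (vector [x, y, z] - vector [x', y', z'] :: real ^ 3) =
     max \<bar>x - x'\<bar> (max \<bar>y - y'\<bar> \<bar>z - z'\<bar>)"
  by (simp add: infnorm_3)

lemma face_3_cases:
  fixes F :: "(real ^ 3) set"
  assumes "F \<in> sphere_faces"
  obtains "F = {p \<in> sup_sphere. p $ 1 = 1}" | "F = {p \<in> sup_sphere. p $ 1 = - 1}"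
    | "F = {p \<in> sup_sphere. p $ 2 = 1}" | "F = {p \<in> sup_sphere. p $ 2 = - 1}"
    | "F = {p \<in> sup_sphere. p $ 3 = 1}" | "F = {p \<in> sup_sphere. p $ 3 = - 1}"
proof -
  from assms obtain i \<sigma> where \<sigma>: "\<sigma> = 1 \<or> \<sigma> = - 1" and F: "F = {p \<in> sup_sphere. p $ i = \<sigma>}"
    unfolding sphere_faces_def by blast
  consider "i = 1" | "i = 2" | "i = 3" using exhaust_3[of i] by blast
  then show thesis
  proof cases
    case 1
    with \<sigma> F that(1,2) show thesis by blast
  next
    case 2
    with \<sigma> F that(3,4) show thesis by blast
  next
    case 3
    with \<sigma> F that(5,6) show thesis by blast
  qed
qed

lemma common_face_3I:
  fixes P Q :: "real ^ 3"
  assumes "P \<in> sup_sphere" "Q \<in> sup_sphere" "P $ i = \<sigma>" "Q $ i = \<sigma>" "\<bar>\<sigma>\<bar> = 1"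
  shows "\<exists>F\<in>sphere_faces. P \<in> F \<and> Q \<in> F"
proof -
  have "\<sigma> = 1 \<or> \<sigma> = - 1" using assms(5) by linarith
  then have "{p \<in> sup_sphere. p $ i = \<sigma>} \<in> (sphere_faces :: (real ^ 3) set set)"
    unfolding sphere_faces_def mem_Collect_eq by (intro exI[of _ i] exI[of _ \<sigma>]) simp
  then show ?thesis
    by (rule bexI[rotated]) (simp add: assms)
qed

section \<open>Potentials and arc length\<close>

lemma sum_le_sup_arc_length:
  assumes "mono_on {..m} t" and "t ` {..m} \<subseteq> {0..1}"
  shows "ereal (\<Sum>i<m. infnorm (g (t (Suc i)) - g (t i))) \<le> sup_arc_length g"
  unfolding sup_arc_length_def by (rule SUP_upper2[of "(m, t)"]) (use assms in auto)

text \<open>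
  Some polygon inscribed in \<open>g\<close> between the parameters \<open>u\<close> and \<open>v\<close> is at least as long as the
  increment of \<open>D\<close> along that part of the curve.
\<close>

definition increment_covered :: "(real \<Rightarrow> real ^ 'n) \<Rightarrow> (real ^ 'n \<Rightarrow> real) \<Rightarrow> real \<Rightarrow> real \<Rightarrow> bool" where
  "increment_covered g D u v \<longleftrightarrow>
     (\<exists>m t. mono_on {..m} t \<and> t 0 = u \<and> t m = v \<and>
        D (g v) - D (g u) \<le> (\<Sum>i<m. infnorm (g (t (Suc i)) - g (t i))))"

lemma increment_covered_trans:
  assumes "increment_covered g D u v" and "increment_covered g D v w"
  shows "increment_covered g D u w"
proof -
  from assms(1) obtain m t where t: "mono_on {..m} t" "t 0 = u" "t m = v"
    "D (g v) - D (g u) \<le> (\<Sum>i<m. infnorm (g (t (Suc i)) - g (t i)))"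
    by (auto simp: increment_covered_def)
  from assms(2) obtain n r where r: "mono_on {..n} r" "r 0 = v" "r n = w"
    "D (g w) - D (g v) \<le> (\<Sum>i<n. infnorm (g (r (Suc i)) - g (r i)))"
    by (auto simp: increment_covered_def)
  define q where "q i = (if i \<le> m then t i else r (i - m))" for i
  have q_shift: "q (m + i) = r i" for i
    using t(3) r(2) by (cases i) (auto simp: q_def)
  have "mono_on {..m + n} q"
  proof (rule mono_onI)
    fix i j assume ij: "i \<in> {..m + n}" "j \<in> {..m + n}" "i \<le> j"
    consider "j \<le> m" | "i \<le> m" "m < j" | "m < i" using ij(3) by linarith
    then show "q i \<le> q j"
    proof cases
      case 1
      then show ?thesis using ij t(1) by (auto simp: q_def mono_on_def)
    next
      case 2
      have "t i \<le> t m" using t(1) 2 by (auto simp: mono_on_def)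
      moreover have "r 0 \<le> r (j - m)" using r(1) 2 ij by (auto simp: mono_on_def)
      ultimately show ?thesis using 2 t(3) r(2) by (simp add: q_def)
    next
      case 3
      have "r (i - m) \<le> r (j - m)" by (rule mono_onD[OF r(1)]) (use 3 ij in auto)
      then show ?thesis using 3 ij by (simp add: q_def)
    qed
  qed
  moreover have "q 0 = u" using t(2) by (simp add: q_def)
  moreover have "q (m + n) = w" using q_shift[of n] r(3) by simp
  moreover have "D (g w) - D (g u) \<le> (\<Sum>i<m + n. infnorm (g (q (Suc i)) - g (q i)))"
  proof -
    have "(\<Sum>i<m + n. infnorm (g (q (Suc i)) - g (q i))) =
        (\<Sum>i<m. infnorm (g (q (Suc i)) - g (q i))) +
        (\<Sum>i<n. infnorm (g (q (Suc (m + i))) - g (q (m + i))))"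
      by (induction n) (auto simp: algebra_simps)
    also have "(\<Sum>i<m. infnorm (g (q (Suc i)) - g (q i))) = (\<Sum>i<m. infnorm (g (t (Suc i)) - g (t i)))"
      by (rule sum.cong) (auto simp: q_def)
    also have "(\<Sum>i<n. infnorm (g (q (Suc (m + i))) - g (q (m + i)))) =
        (\<Sum>i<n. infnorm (g (r (Suc i)) - g (r i)))"
      using q_shift q_shift[of "Suc i" for i] by (intro sum.cong) simp_all
    finally show ?thesis using t(4) r(4) by linarith
  qed
  ultimately show ?thesis unfolding increment_covered_def by blast
qed

text \<open>
  Nearby points of the sphere need not share a face (they may lie on either side of an edge), but
  every point close enough to a given one shares a face with it, since the faces are closed and
  finitely many.
\<close>

lemma locally_common_face:
  fixes g :: "real \<Rightarrow> real ^ 'n"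
  assumes g: "path g" "path_image g \<subseteq> sup_sphere" and x: "x \<in> {0..1}"
  shows "\<exists>\<delta>>0. \<forall>y\<in>{0..1}. \<bar>y - x\<bar> < \<delta> \<longrightarrow> (\<exists>F\<in>sphere_faces. g x \<in> F \<and> g y \<in> F)"
proof -
  define K where "K = \<Union> {F \<in> sphere_faces. g x \<notin> F}"
  have "closed K" unfolding K_def
    by (rule closed_Union) (auto intro: closed_face finite_subset[OF _ finite_sphere_faces])
  moreover have "g x \<notin> K" by (auto simp: K_def)
  ultimately obtain e where e: "e > 0" "ball (g x) e \<subseteq> - K"
    using openE[of "- K" "g x"] by auto
  have "\<exists>\<delta>>0. \<forall>y\<in>{0..1}. dist y x < \<delta> \<longrightarrow> dist (g y) (g x) < e"
    using g(1) x e(1) unfolding path_def continuous_on_iff by auto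
  then obtain \<delta> where \<delta>: "\<delta> > 0"
    "\<And>y. y \<in> {0..1} \<Longrightarrow> dist y x < \<delta> \<Longrightarrow> dist (g y) (g x) < e"
    by auto
  show ?thesis
  proof (intro exI[of _ \<delta>] conjI ballI impI)
    fix y assume y: "y \<in> {0..1}" "\<bar>y - x\<bar> < \<delta>"
    then have "g y \<notin> K" using \<delta>(2)[OF y(1)] e(2) by (auto simp: dist_real_def dist_commute subset_iff)
    moreover have "g y \<in> \<Union> sphere_faces"
      using y(1) g(2) by (auto simp: Union_sphere_faces path_image_def)
    ultimately show "\<exists>F\<in>sphere_faces. g x \<in> F \<and> g y \<in> F" by (auto simp: K_def)
  qed (fact \<delta>(1))
qed

text \<open>
  A function that is 1-Lipschitz on every face separately cannot increase along a curve by more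
  than the length of the curve. The interval is bisected; near a parameter \<open>x\<close>, the curve point at
  \<open>x\<close> itself is inserted into the inscribed polygon, because each of its neighbours shares a face
  with it.
\<close>

lemma potential_le_sup_arc_length:
  fixes g :: "real \<Rightarrow> real ^ 'n"
  assumes g: "path g" "path_image g \<subseteq> sup_sphere"
    and D: "\<And>F P Q. F \<in> sphere_faces \<Longrightarrow> P \<in> F \<Longrightarrow> Q \<in> F \<Longrightarrow> D Q - D P \<le> infnorm (Q - P)"
  shows "ereal (D (pathfinish g) - D (pathstart g)) \<le> sup_arc_length g"
proof -
  let ?P = "\<lambda>u v. 0 \<le> u \<longrightarrow> v \<le> 1 \<longrightarrow> increment_covered g D u v"
  have "?P 0 1"
  proof (rule Bolzano[where P = ?P])
    fix u v w :: real
    assume "?P u v" "?P v w" "u \<le> v" "v \<le> w"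
    then show "?P u w" using increment_covered_trans[of g D u v w] by auto
  next
    fix x :: real assume x: "0 \<le> x" "x \<le> 1"
    then obtain \<delta> where \<delta>: "\<delta> > 0" and face:
      "\<And>y. y \<in> {0..1} \<Longrightarrow> \<bar>y - x\<bar> < \<delta> \<Longrightarrow> \<exists>F\<in>sphere_faces. g x \<in> F \<and> g y \<in> F"
      using locally_common_face[OF g, of x] by auto
    show "\<exists>d>0. \<forall>u v. u \<le> x \<and> x \<le> v \<and> v - u < d \<longrightarrow> ?P u v"
    proof (intro exI[of _ \<delta>] conjI allI impI)
      fix u v assume uv: "u \<le> x \<and> x \<le> v \<and> v - u < \<delta>" "0 \<le> u" "v \<le> 1"
      define t where "t i = (if i = 0 then u else if i = 1 then x else v)" for i :: nat
      obtain F where F: "F \<in> sphere_faces" "g x \<in> F" "g u \<in> F" using face[of u] uv x by auto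
      obtain G where G: "G \<in> sphere_faces" "g x \<in> G" "g v \<in> G" using face[of v] uv x by auto
      have "D (g v) - D (g u) \<le> (\<Sum>i<2. infnorm (g (t (Suc i)) - g (t i)))"
        using D[OF F(1) F(3) F(2)] D[OF G] by (simp add: numeral_2_eq_2 t_def)
      moreover have "mono_on {..2} t" using uv by (auto simp: mono_on_def t_def)
      ultimately show "increment_covered g D u v"
        unfolding increment_covered_def by (intro exI[of _ 2] exI[of _ t]) (auto simp: t_def)
    qed (fact \<delta>)
  qed simp
  then obtain m t where t: "mono_on {..m} t" "t 0 = 0" "t m = 1"
    "D (g 1) - D (g 0) \<le> (\<Sum>i<m. infnorm (g (t (Suc i)) - g (t i)))"
    by (auto simp: increment_covered_def)
  have "0 \<le> t i \<and> t i \<le> 1" if "i \<le> m" for i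
    using mono_onD[OF t(1), of 0 i] mono_onD[OF t(1), of i m] t(2,3) that by auto
  then have "t ` {..m} \<subseteq> {0..1}" by auto
  then have "ereal (\<Sum>i<m. infnorm (g (t (Suc i)) - g (t i))) \<le> sup_arc_length g"
    by (rule sum_le_sup_arc_length[OF t(1)])
  moreover have "ereal (D (g 1) - D (g 0)) \<le> ereal (\<Sum>i<m. infnorm (g (t (Suc i)) - g (t i)))"
    using t(4) by simp
  ultimately show ?thesis
    unfolding pathstart_def pathfinish_def by (rule order_trans[rotated])
qed

section \<open>Lengths of unfolded routes\<close>

text \<open>
  The unfolded distance from \<open>(1, a, b)\<close> to the point \<open>(x, 1, z)\<close> of the side face \<open>y = 1\<close>. The three
  terms are the sup norms of the displacement after unfolding the faces along the direct route and along
  the routes through \<open>z = 1\<close> and through \<open>z = - 1\<close>. The other side faces are reached by reflecting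
  and swapping the coordinates.
\<close>

definition side_dist :: "real \<Rightarrow> real \<Rightarrow> real \<Rightarrow> real \<Rightarrow> real" where
  "side_dist a b x z =
     min (max (2 - x - a) \<bar>z - b\<bar>)
       (min (max (2 - z - a) (2 - x - b)) (max (2 + z - a) (2 - x + b)))"

text \<open>
  The shortest of the three routes from \<open>(1, a, b)\<close> to \<open>(- 1, c, d)\<close> that enter the face \<open>x = - 1\<close>
  from the face \<open>y = 1\<close>, measured in the unfolding: through \<open>y = 1\<close> only, through \<open>z = 1\<close> and \<open>y = 1\<close>,
  and through \<open>z = - 1\<close> and \<open>y = 1\<close>.
\<close>

definition opposite_route :: "real \<Rightarrow> real \<Rightarrow> real \<Rightarrow> real \<Rightarrow> real" where
  "opposite_route a b c d =
     min (4 - a - c) (min (max (2 - a - d) (4 - b - c)) (max (2 - a + d) (4 + b - c)))"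

text \<open>
  The minimum of all twelve routes to \<open>(- 1, c, d)\<close>, grouped by the side face from which the face
  \<open>x = - 1\<close> is entered: \<open>y = 1\<close>, \<open>y = - 1\<close>, \<open>z = 1\<close> and \<open>z = - 1\<close>.
\<close>

definition opposite_dist :: "real \<Rightarrow> real \<Rightarrow> real \<Rightarrow> real \<Rightarrow> real" where
  "opposite_dist a b c d =
     min (min (opposite_route a b c d) (opposite_route (- a) b (- c) d))
       (min (opposite_route b a d c) (opposite_route (- b) a (- d) c))"

lemma abs_max_diff_le: "\<bar>max u v - max u' v'\<bar> \<le> k" if "\<bar>u - u'\<bar> \<le> k" "\<bar>v - v'\<bar> \<le> k" for u v k :: real
  using that by linarith

lemma abs_min_diff_le: "\<bar>min u v - min u' v'\<bar> \<le> k" if "\<bar>u - u'\<bar> \<le> k" "\<bar>v - v'\<bar> \<le> k" for u v k :: real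
  using that by linarith

lemma side_dist_lipschitz:
  assumes "\<bar>x - x'\<bar> \<le> k" "\<bar>z - z'\<bar> \<le> k"
  shows "\<bar>side_dist a b x z - side_dist a b x' z'\<bar> \<le> k"
  unfolding side_dist_def
  by (intro abs_max_diff_le abs_min_diff_le) (use assms in linarith)+

lemma opposite_route_lipschitz:
  assumes "\<bar>c - c'\<bar> \<le> k" "\<bar>d - d'\<bar> \<le> k"
  shows "\<bar>opposite_route a b c d - opposite_route a b c' d'\<bar> \<le> k"
  unfolding opposite_route_def
  by (intro abs_max_diff_le abs_min_diff_le) (use assms in linarith)+

lemma opposite_dist_lipschitz:
  assumes "\<bar>c - c'\<bar> \<le> k" "\<bar>d - d'\<bar> \<le> k"
  shows "\<bar>opposite_dist a b c d - opposite_dist a b c' d'\<bar> \<le> k"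
  unfolding opposite_dist_def
  by (intro abs_min_diff_le opposite_route_lipschitz) (use assms in linarith)+

lemma side_dist_reflect: "side_dist a (- b) x (- z) = side_dist a b x z"
  by (simp add: side_dist_def min.commute abs_minus_commute add.commute)

lemma opposite_route_reflect: "opposite_route a (- b) c (- d) = opposite_route a b c d"
  by (simp add: opposite_route_def min.commute)

lemma opposite_dist_reflect: "opposite_dist (- a) b (- c) d = opposite_dist a b c d"
  using opposite_route_reflect[of b a d c] opposite_route_reflect[of "- b" a "- d" c]
  by (simp add: opposite_dist_def min.commute)

lemma opposite_dist_swap: "opposite_dist b a d c = opposite_dist a b c d"
  by (simp add: opposite_dist_def min.commute min.assoc)

context
  fixes a b :: real
  assumes ab: "\<bar>a\<bar> \<le> 1" "\<bar>b\<bar> \<le> 1"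
begin

lemma side_dist_start:
  assumes "\<bar>z\<bar> \<le> 1"
  shows "side_dist a b 1 z = max (1 - a) \<bar>z - b\<bar>"
proof -
  have "max (1 - a) \<bar>z - b\<bar> \<le> max (2 - z - a) (1 - b)"
    and "max (1 - a) \<bar>z - b\<bar> \<le> max (2 + z - a) (1 + b)"
    using ab assms by linarith+
  then show ?thesis by (simp add: side_dist_def min_absorb1)
qed

lemma side_dist_corner:
  assumes "\<bar>x\<bar> \<le> 1"
  shows "side_dist a b x 1 = min (max (2 - x - a) (1 - b)) (max (2 - x - b) (1 - a))"
proof -
  have "max (2 - x - a) (1 - b) \<le> max (3 - a) (2 - x + b)"
    using ab assms by linarith
  then have "min (max (2 - x - a) (1 - b)) (min m (max (3 - a) (2 - x + b))) =
      min (max (2 - x - a) (1 - b)) m" for m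
    by (simp add: min.left_commute min_absorb1)
  moreover have "side_dist a b x 1 = min (max (2 - x - a) (1 - b))
      (min (max (2 - x - b) (1 - a)) (max (3 - a) (2 - x + b)))"
    using ab by (simp add: side_dist_def max.commute)
  ultimately show ?thesis by simp
qed

text \<open>
  At a point of the edge shared by the faces \<open>y = 1\<close> and \<open>x = - 1\<close>, the routes that enter \<open>x = - 1\<close>
  from \<open>y = 1\<close> are the shortest ones. So the formulas for the unfolded distance on the two faces agree on
  this edge, as \<open>side_dist_end\<close> states.
\<close>

lemma opposite_route_le_adjacent:
  assumes "\<bar>z\<bar> \<le> 1"
  shows "opposite_route a b 1 z \<le> opposite_route b a z 1"
proof -
  have 1: "opposite_route a b 1 z \<le> 3 - a"
    and 2: "opposite_route a b 1 z \<le> max (2 - a - z) (3 - b)"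
    unfolding opposite_route_def by (simp_all add: min_le_iff_disj)
  have "opposite_route a b 1 z \<le> 4 - b - z"
    by (intro order_trans[OF 2]) (use ab assms in linarith)
  moreover have "opposite_route a b 1 z \<le> max (2 - b - 1) (4 - a - z)"
    using ab assms by (intro order_trans[OF 1]) simp
  moreover have "opposite_route a b 1 z \<le> max (2 - b + 1) (4 + a - z)"
    by (intro order_trans[OF 2]) (use ab assms in linarith)
  ultimately show ?thesis unfolding opposite_route_def[of b] by (intro min.boundedI)
qed

lemma opposite_route_le_opposite:
  assumes "\<bar>z\<bar> \<le> 1"
  shows "opposite_route a b 1 z \<le> opposite_route (- a) b (- 1) z"
  unfolding opposite_route_def by (intro min.mono) (use ab assms in linarith)+

end

lemma side_dist_end:
  assumes "\<bar>a\<bar> \<le> 1" "\<bar>b\<bar> \<le> 1" "\<bar>z\<bar> \<le> 1"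
  shows "side_dist a b (- 1) z = opposite_dist a b 1 z"
proof -
  have "side_dist a b (- 1) z = opposite_route a b 1 z"
    using assms by (simp add: opposite_route_def side_dist_def algebra_simps)
  moreover have "opposite_route a b 1 z \<le> opposite_route (- b) a (- z) 1"
    using opposite_route_le_adjacent[of a "- b" "- z"] assms by (simp add: opposite_route_reflect)
  ultimately show ?thesis
    using opposite_route_le_adjacent[of a b z] opposite_route_le_opposite[of a b z] assms
    by (simp add: opposite_dist_def min_absorb1)
qed

section \<open>The distance from a point of the first face\<close>

text \<open>
  The unfolded distance from \<open>(1, a, b)\<close> to a point \<open>p\<close> of the sphere, defined by one formula on each
  face. On an edge the first applicable formula is used; the lemmas below show that the formula of the
  other face gives the same value.
\<close>

definition unfolded_dist :: "real \<Rightarrow> real \<Rightarrow> real ^ 3 \<Rightarrow> real" where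
  "unfolded_dist a b p =
     (if p $ 1 = 1 then max \<bar>p $ 2 - a\<bar> \<bar>p $ 3 - b\<bar>
      else if p $ 1 = - 1 then opposite_dist a b (p $ 2) (p $ 3)
      else if p $ 2 = 1 then side_dist a b (p $ 1) (p $ 3)
      else if p $ 2 = - 1 then side_dist (- a) b (p $ 1) (p $ 3)
      else if p $ 3 = 1 then side_dist b a (p $ 1) (p $ 2)
      else side_dist (- b) a (p $ 1) (p $ 2))"

context
  fixes a b :: real and p :: "real ^ 3"
  assumes ab: "\<bar>a\<bar> \<le> 1" "\<bar>b\<bar> \<le> 1" and p: "p \<in> sup_sphere"
begin

lemma abs_component_le_1: "\<bar>p $ i\<bar> \<le> 1"
  using p by (simp add: mem_sup_sphere_iff)

lemma unfolded_dist_right: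
  assumes "p $ 2 = 1"
  shows "unfolded_dist a b p = side_dist a b (p $ 1) (p $ 3)"
proof -
  have "side_dist a b 1 (p $ 3) = max (1 - a) \<bar>p $ 3 - b\<bar>"
    using ab abs_component_le_1 by (intro side_dist_start)
  moreover have "side_dist a b (- 1) (p $ 3) = opposite_dist a b 1 (p $ 3)"
    using ab abs_component_le_1 by (intro side_dist_end)
  moreover have "\<bar>1 - a\<bar> = 1 - a" using ab by simp
  ultimately show ?thesis using assms by (auto simp: unfolded_dist_def)
qed

lemma unfolded_dist_left:
  assumes "p $ 2 = - 1"
  shows "unfolded_dist a b p = side_dist (- a) b (p $ 1) (p $ 3)"
proof -
  have "side_dist (- a) b 1 (p $ 3) = max (1 - - a) \<bar>p $ 3 - b\<bar>"
    using ab abs_component_le_1 by (intro side_dist_start) auto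
  moreover have "side_dist (- a) b (- 1) (p $ 3) = opposite_dist (- a) b (- (- 1)) (p $ 3)"
    using ab abs_component_le_1 by (simp add: side_dist_end)
  moreover have "\<bar>- 1 - a\<bar> = 1 + a" using ab by simp
  ultimately show ?thesis using assms
    by (auto simp: unfolded_dist_def opposite_dist_reflect simp del: minus_minus)
qed

lemma unfolded_dist_top:
  assumes "p $ 3 = 1"
  shows "unfolded_dist a b p = side_dist b a (p $ 1) (p $ 2)"
proof -
  have "side_dist b a 1 (p $ 2) = max (1 - b) \<bar>p $ 2 - a\<bar>"
    using ab abs_component_le_1 by (intro side_dist_start)
  moreover have "side_dist b a (- 1) (p $ 2) = opposite_dist a b (p $ 2) 1"
    using ab abs_component_le_1 opposite_dist_swap[of b a 1 "p $ 2"] by (simp add: side_dist_end)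
  moreover have "\<bar>1 - b\<bar> = 1 - b" using ab by simp
  moreover have "side_dist a b (p $ 1) 1 = side_dist b a (p $ 1) 1"
    using ab abs_component_le_1 by (simp add: side_dist_corner min.commute)
  moreover have "side_dist (- a) b (p $ 1) 1 = side_dist b a (p $ 1) (- 1)"
    using ab abs_component_le_1 side_dist_reflect[of b "- a" "p $ 1" 1]
    by (simp add: side_dist_corner min.commute)
  ultimately show ?thesis using assms by (auto simp: unfolded_dist_def max.commute)
qed

lemma unfolded_dist_bottom:
  assumes "p $ 3 = - 1"
  shows "unfolded_dist a b p = side_dist (- b) a (p $ 1) (p $ 2)"
proof -
  have "side_dist (- b) a 1 (p $ 2) = max (1 - - b) \<bar>p $ 2 - a\<bar>"
    using ab abs_component_le_1 by (intro side_dist_start) auto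
  moreover have "side_dist (- b) a (- 1) (p $ 2) = opposite_dist a b (p $ 2) (- 1)"
    using ab abs_component_le_1 opposite_dist_swap[of b a "- 1" "p $ 2"] opposite_dist_reflect[of b a "- 1"]
    by (simp add: side_dist_end)
  moreover have "\<bar>- 1 - b\<bar> = 1 + b" using ab by simp
  moreover have "side_dist a b (p $ 1) (- 1) = side_dist (- b) a (p $ 1) 1"
    using ab abs_component_le_1 side_dist_reflect[of a "- b" "p $ 1" 1]
    by (simp add: side_dist_corner min.commute)
  moreover have "side_dist (- a) b (p $ 1) (- 1) = side_dist (- b) a (p $ 1) (- 1)"
    using ab abs_component_le_1 side_dist_reflect[of "- a" "- b" "p $ 1" 1]
      side_dist_reflect[of "- b" "- a" "p $ 1" 1]
    by (simp add: side_dist_corner min.commute)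
  ultimately show ?thesis using assms by (auto simp: unfolded_dist_def max.commute)
qed

end

lemma unfolded_dist_lipschitz_on_face:
  fixes F :: "(real ^ 3) set"
  assumes ab: "\<bar>a\<bar> \<le> 1" "\<bar>b\<bar> \<le> 1"
    and F: "F \<in> sphere_faces" "p \<in> F" "q \<in> F"
  shows "unfolded_dist a b q - unfolded_dist a b p \<le> infnorm (q - p)"
proof -
  have sphere: "p \<in> sup_sphere" "q \<in> sup_sphere"
    using F Union_sphere_faces by blast+
  have comp: "\<bar>q $ i - p $ i\<bar> \<le> infnorm (q - p)" for i
    using component_le_infnorm_cart[of "q - p" i] by simp
  have route: "side_dist u v (q $ i) (q $ j) - side_dist u v (p $ i) (p $ j) \<le> infnorm (q - p)" for u v i j
    using side_dist_lipschitz[OF comp[of i] comp[of j], of u v] by linarith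
  from F(1) show ?thesis
  proof (cases rule: face_3_cases)
    case 1
    have "max (\<bar>q $ 2 - a\<bar>) (\<bar>q $ 3 - b\<bar>) - max (\<bar>p $ 2 - a\<bar>) (\<bar>p $ 3 - b\<bar>) \<le> infnorm (q - p)"
      by (rule abs_le_D1, rule abs_max_diff_le) (use comp[of 2] comp[of 3] in linarith)+
    with 1 F show ?thesis by (simp add: unfolded_dist_def)
  next
    case 2
    with F opposite_dist_lipschitz[OF comp[of 2] comp[of 3], of a b] show ?thesis
      by (simp add: unfolded_dist_def)
  next
    case 3
    with F route ab show ?thesis by (simp add: unfolded_dist_right)
  next
    case 4
    with F route ab show ?thesis by (simp add: unfolded_dist_left)
  next
    case 5
    with F route ab show ?thesis by (simp add: unfolded_dist_top)
  next
    case 6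
    with F route ab show ?thesis by (simp add: unfolded_dist_bottom)
  qed
qed

section \<open>Symmetries of the sphere\<close>

text \<open>
  Some admissible path from \<open>A\<close> to \<open>B\<close> has sup-norm arc length at most \<open>l\<close>.
\<close>

definition joined_within :: "real ^ 'n \<Rightarrow> real ^ 'n \<Rightarrow> real \<Rightarrow> bool" where
  "joined_within A B l \<longleftrightarrow> (\<exists>g. admissible_path A B g \<and> sup_arc_length g \<le> ereal l)"

text \<open>
  Signed coordinate permutations preserve the sup norm and permute the faces.
\<close>

lemma joined_within_signed_permutation:
  fixes A B :: "real ^ 'n" and \<epsilon> :: "'n \<Rightarrow> real" and \<pi> :: "'n \<Rightarrow> 'n"
  assumes \<epsilon>: "\<And>i. \<bar>\<epsilon> i\<bar> = 1" and \<pi>: "bij \<pi>" and "joined_within A B l"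
  shows "joined_within (\<chi> i. \<epsilon> i * A $ \<pi> i) (\<chi> i. \<epsilon> i * B $ \<pi> i) l"
proof -
  define f :: "real ^ 'n \<Rightarrow> real ^ 'n" where "f x = (\<chi> i. \<epsilon> i * x $ \<pi> i)" for x
  have "linear f"
    by (rule linearI) (auto simp: f_def vec_eq_iff algebra_simps)
  have abs_f: "\<bar>f x $ i\<bar> = \<bar>x $ \<pi> i\<bar>" for x i
    by (simp add: f_def abs_mult \<epsilon>)
  have infnorm_f: "infnorm (f x) = infnorm x" for x
  proof (rule antisym)
    show "infnorm (f x) \<le> infnorm x"
      by (simp add: infnorm_le_iff abs_f component_le_infnorm_cart)
    show "infnorm x \<le> infnorm (f x)"
      unfolding infnorm_le_iff
    proof
      fix j
      have "\<bar>x $ j\<bar> = \<bar>f x $ (inv \<pi> j)\<bar>"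
        using \<pi> by (simp add: abs_f bij_is_surj surj_f_inv_f)
      then show "\<bar>x $ j\<bar> \<le> infnorm (f x)" by (simp add: component_le_infnorm_cart)
    qed
  qed
  have face_f: "f -` F \<in> sphere_faces" if F: "F \<in> sphere_faces" for F
  proof -
    from F obtain i \<sigma> where \<sigma>: "\<bar>\<sigma>\<bar> = 1" "F = {x \<in> sup_sphere. x $ i = \<sigma>}"
      by (rule sphere_facesE)
    have "\<epsilon> i * y = \<sigma> \<longleftrightarrow> y = \<epsilon> i * \<sigma>" for y
      using \<epsilon>[of i] by (auto simp: abs_if split: if_splits)
    then have "f -` F = {x \<in> sup_sphere. x $ \<pi> i = \<epsilon> i * \<sigma>}"
      using \<sigma>(2) by (simp add: sup_sphere_def infnorm_f) (simp add: f_def)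
    moreover have "\<epsilon> i * \<sigma> = 1 \<or> \<epsilon> i * \<sigma> = - 1"
      using \<epsilon>[of i] \<sigma>(1) by (auto simp: abs_if split: if_splits)
    ultimately show ?thesis unfolding sphere_faces_def by blast
  qed
  from assms(3) obtain g where g: "admissible_path A B g" "sup_arc_length g \<le> ereal l"
    by (auto simp: joined_within_def)
  have "admissible_path (f A) (f B) (f \<circ> g)"
    unfolding admissible_path_def
  proof (intro conjI ballI impI)
    show "path (f \<circ> g)"
      using g(1) \<open>linear f\<close> unfolding admissible_path_def
      by (intro path_continuous_image linear_continuous_on) (auto simp: linear_conv_bounded_linear)
    show "path_image (f \<circ> g) \<subseteq> sup_sphere"
      using g(1) by (auto simp: admissible_path_def path_image_compose sup_sphere_def infnorm_f)
    show "pathstart (f \<circ> g) = f A" "pathfinish (f \<circ> g) = f B"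
      using g(1) by (auto simp: admissible_path_def pathstart_compose pathfinish_compose)
    fix F :: "(real ^ 'n) set"
    assume F: "F \<in> sphere_faces" "path_image (f \<circ> g) \<inter> F \<noteq> {}"
    have eq: "path_image (f \<circ> g) \<inter> F = f ` (path_image g \<inter> f -` F)"
      by (auto simp: path_image_compose)
    with F g(1) face_f[OF F(1)] obtain P Q where "path_image g \<inter> f -` F = closed_segment P Q"
      unfolding admissible_path_def by (metis image_empty)
    then have "path_image (f \<circ> g) \<inter> F = closed_segment (f P) (f Q)"
      using eq closed_segment_linear_image[OF \<open>linear f\<close>] by simp
    then show "\<exists>P Q. path_image (f \<circ> g) \<inter> F = closed_segment P Q" by blast
  qed
  moreover have "infnorm (f x - f y) = infnorm (x - y)" for x y
    using infnorm_f[of "x - y"] linear_diff[OF \<open>linear f\<close>] by simp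
  then have "sup_arc_length (f \<circ> g) = sup_arc_length g"
    by (simp add: sup_arc_length_def)
  ultimately show ?thesis
    using g(2) unfolding joined_within_def f_def by auto
qed

lemma joined_within_reflect:
  assumes "joined_within (vector [x, a, b] :: real ^ 3) (vector [y, c, d]) l"
  shows "joined_within (vector [x, - a, b] :: real ^ 3) (vector [y, - c, d]) l"
proof -
  let ?\<epsilon> = "\<lambda>i :: 3. if i = 2 then - 1 else 1 :: real"
  have "(\<chi> i. ?\<epsilon> i * (vector [u, v, w] :: real ^ 3) $ id i) = vector [u, - v, w]" for u v w
    by (simp add: vec_eq_iff forall_3)
  with joined_within_signed_permutation[of ?\<epsilon> id, OF _ bij_id assms] show ?thesis by simp
qed

lemma joined_within_swap:
  assumes "joined_within (vector [x, a, b] :: real ^ 3) (vector [y, c, d]) l"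
  shows "joined_within (vector [x, b, a] :: real ^ 3) (vector [y, d, c]) l"
proof -
  let ?\<pi> = "\<lambda>i :: 3. if i = 2 then 3 else if i = 3 then 2 else 1 :: 3"
  have "?\<pi> (?\<pi> i) = i" for i using exhaust_3[of i] by auto
  then have "bij ?\<pi>" by (intro o_bij[of ?\<pi>]) (auto simp: fun_eq_iff)
  moreover have "(\<chi> i. 1 * (vector [u, v, w] :: real ^ 3) $ ?\<pi> i) = vector [u, w, v]" for u v w
    by (simp add: vec_eq_iff forall_3)
  ultimately show ?thesis
    using joined_within_signed_permutation[of "\<lambda>_. 1" ?\<pi>, OF _ _ assms] by simp
qed

section \<open>Polygonal paths\<close>

text \<open>
  The curve has a length function \<open>\<phi>\<close> of total increment \<open>L\<close> that dominates all its chords. This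
  bounds every inscribed polygon by a telescoping sum, and such functions can be concatenated.
\<close>

definition length_controlled :: "(real \<Rightarrow> real ^ 'n) \<Rightarrow> real \<Rightarrow> bool" where
  "length_controlled g L \<longleftrightarrow>
     (\<exists>\<phi>. (\<forall>s t. 0 \<le> s \<longrightarrow> s \<le> t \<longrightarrow> t \<le> 1 \<longrightarrow> infnorm (g t - g s) \<le> \<phi> t - \<phi> s) \<and>
          \<phi> 1 - \<phi> 0 = L)"

lemma sup_arc_length_le:
  assumes "length_controlled g L"
  shows "sup_arc_length g \<le> ereal L"
proof -
  from assms obtain \<phi> where
    \<phi>: "\<And>s t. 0 \<le> s \<Longrightarrow> s \<le> t \<Longrightarrow> t \<le> 1 \<Longrightarrow> infnorm (g t - g s) \<le> \<phi> t - \<phi> s" and L: "\<phi> 1 - \<phi> 0 = L"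
    unfolding length_controlled_def by blast
  have mono: "\<phi> s \<le> \<phi> t" if "0 \<le> s" "s \<le> t" "t \<le> 1" for s t
    using \<phi>[OF that] infnorm_pos_le[of "g t - g s"] by linarith
  have "(\<Sum>i<m. infnorm (g (t (Suc i)) - g (t i))) \<le> L"
    if t: "mono_on {..m} t" "t ` {..m} \<subseteq> {0..1}" for m t
  proof -
    have t01: "0 \<le> t i" "t i \<le> 1" if "i \<le> m" for i
      using t(2) that by auto
    have "(\<Sum>i<m. infnorm (g (t (Suc i)) - g (t i))) \<le> (\<Sum>i<m. \<phi> (t (Suc i)) - \<phi> (t i))"
      by (intro sum_mono \<phi>) (auto intro: t01 mono_onD[OF t(1)])
    also have "\<dots> = \<phi> (t m) - \<phi> (t 0)" by (rule sum_lessThan_telescope)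
    also have "\<dots> \<le> \<phi> 1 - \<phi> 0" using mono[of "t m" 1] mono[of 0 "t 0"] t01[of m] t01[of 0] by simp
    finally show ?thesis using L by simp
  qed
  then show ?thesis unfolding sup_arc_length_def by (auto intro!: SUP_least)
qed

lemma length_controlled_linepath: "length_controlled (linepath P Q) (infnorm (Q - P))"
proof -
  have "infnorm (linepath P Q t - linepath P Q s) = t * infnorm (Q - P) - s * infnorm (Q - P)"
    if "s \<le> t" for s t
  proof -
    have "linepath P Q t - linepath P Q s = (t - s) *\<^sub>R (Q - P)"
      by (simp add: linepath_def algebra_simps)
    then have "infnorm (linepath P Q t - linepath P Q s) = (t - s) * infnorm (Q - P)"
      using that by (simp add: infnorm_mul)
    then show ?thesis by (simp add: algebra_simps)
  qed
  then show ?thesis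
    unfolding length_controlled_def by (intro exI[of _ "\<lambda>t. t * infnorm (Q - P)"]) auto
qed

lemma length_controlled_join:
  assumes "length_controlled g L" and "length_controlled h M" and join: "pathfinish g = pathstart h"
  shows "length_controlled (g +++ h) (L + M)"
proof -
  from assms(1) obtain \<phi> where
    \<phi>: "\<And>s t. 0 \<le> s \<Longrightarrow> s \<le> t \<Longrightarrow> t \<le> 1 \<Longrightarrow> infnorm (g t - g s) \<le> \<phi> t - \<phi> s" and L: "\<phi> 1 - \<phi> 0 = L"
    unfolding length_controlled_def by blast
  from assms(2) obtain m where
    m: "\<And>s t. 0 \<le> s \<Longrightarrow> s \<le> t \<Longrightarrow> t \<le> 1 \<Longrightarrow> infnorm (h t - h s) \<le> m t - m s" and M: "m 1 - m 0 = M"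
    unfolding length_controlled_def by blast
  define k where "k t = (if t \<le> 1 / 2 then \<phi> (2 * t) else \<phi> 1 + (m (2 * t - 1) - m 0))" for t
  have "infnorm ((g +++ h) t - (g +++ h) s) \<le> k t - k s" if st: "0 \<le> s" "s \<le> t" "t \<le> 1" for s t
  proof -
    consider "t \<le> 1 / 2" | "s \<le> 1 / 2" "1 / 2 < t" | "1 / 2 < s" using st by linarith
    then show ?thesis
    proof cases
      case 1
      then show ?thesis using \<phi>[of "2 * s" "2 * t"] st by (simp add: joinpaths_def k_def)
    next
      case 2
      have "(g +++ h) t - (g +++ h) s = (h (2 * t - 1) - h 0) + (g 1 - g (2 * s))"
        using 2 join by (simp add: joinpaths_def pathfinish_def pathstart_def)
      then have "infnorm ((g +++ h) t - (g +++ h) s) \<le>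
          infnorm (h (2 * t - 1) - h 0) + infnorm (g 1 - g (2 * s))"
        by (simp only: infnorm_triangle)
      also have "\<dots> \<le> (m (2 * t - 1) - m 0) + (\<phi> 1 - \<phi> (2 * s))"
        using 2 st by (intro add_mono m \<phi>) auto
      finally show ?thesis using 2 by (simp add: k_def)
    next
      case 3
      then show ?thesis using m[of "2 * s - 1" "2 * t - 1"] st by (simp add: joinpaths_def k_def)
    qed
  qed
  moreover have "k 1 - k 0 = L + M" using L M by (simp add: k_def)
  ultimately show ?thesis unfolding length_controlled_def by blast
qed

text \<open>
  The broken line with first vertex \<open>P\<close> and further vertices \<open>vs\<close>. It ends with a constant piece,
  so that the empty list needs no separate treatment.
\<close>

fun polygonal_path :: "'a :: real_normed_vector \<Rightarrow> 'a list \<Rightarrow> real \<Rightarrow> 'a" where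
  "polygonal_path P [] = linepath P P"
| "polygonal_path P (Q # vs) = linepath P Q +++ polygonal_path Q vs"

lemma pathstart_polygonal_path [simp]: "pathstart (polygonal_path P vs) = P"
  by (cases vs) auto

lemma pathfinish_polygonal_path [simp]: "pathfinish (polygonal_path P vs) = last (P # vs)"
  by (induction vs arbitrary: P) auto

lemma path_polygonal_path: "path (polygonal_path P vs)"
  by (induction vs arbitrary: P) auto

lemma path_image_polygonal_path:
  "path_image (polygonal_path P vs) =
     insert (last (P # vs)) (\<Union>(Q, R)\<in>set (zip (P # vs) vs). closed_segment Q R)"
  by (induction vs arbitrary: P) (auto simp: path_image_join)

lemma length_controlled_polygonal_path:
  "length_controlled (polygonal_path P vs) (\<Sum>(Q, R)\<leftarrow>zip (P # vs) vs. infnorm (R - Q))"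
proof (induction vs arbitrary: P)
  case Nil
  show ?case using length_controlled_linepath[of P P]
    by (simp only: polygonal_path.simps zip.simps list.map sum_list.Nil diff_self infnorm_0)
next
  case (Cons Q vs)
  show ?case using length_controlled_join[OF length_controlled_linepath Cons.IH] by simp
qed

text \<open>
  A face of the sphere is an extreme subset: a segment with end points on the sphere meets it in its
  relative interior only if the whole segment lies in it.
\<close>

lemma face_extreme:
  fixes F :: "(real ^ 'n) set"
  assumes F: "F \<in> sphere_faces" and PQ: "P \<in> sup_sphere" "Q \<in> sup_sphere"
    and X: "X \<in> open_segment P Q" "X \<in> F"
  shows "P \<in> F \<and> Q \<in> F"
proof -
  from F obtain i \<sigma> where \<sigma>: "\<bar>\<sigma>\<bar> = 1" and F_eq: "F = {x \<in> sup_sphere. x $ i = \<sigma>}"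
    by (rule sphere_facesE)
  from X(1) obtain u where u: "0 < u" "u < 1" "X = (1 - u) *\<^sub>R P + u *\<^sub>R Q"
    by (auto simp: in_segment)
  have le: "\<sigma> * P $ i \<le> 1" "\<sigma> * Q $ i \<le> 1"
    using PQ \<sigma> abs_ge_self[of "\<sigma> * _"] by (auto simp: mem_sup_sphere_iff abs_mult intro: order_trans)
  have "\<sigma> * X $ i = 1" using X(2) \<sigma> by (auto simp: F_eq abs_if split: if_splits)
  then have sum: "(1 - u) * (1 - \<sigma> * P $ i) + u * (1 - \<sigma> * Q $ i) = 0"
    by (simp add: u(3) algebra_simps)
  moreover have "0 \<le> (1 - u) * (1 - \<sigma> * P $ i)" "0 \<le> u * (1 - \<sigma> * Q $ i)"
    using u le by auto
  ultimately have "(1 - u) * (1 - \<sigma> * P $ i) = 0" "u * (1 - \<sigma> * Q $ i) = 0"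
    by linarith+
  then have "\<sigma> * P $ i = 1" "\<sigma> * Q $ i = 1" using u by auto
  then have "P $ i = \<sigma>" "Q $ i = \<sigma>" using \<sigma> by (auto simp: abs_if split: if_splits)
  with PQ show ?thesis by (simp add: F_eq)
qed

text \<open>
  A broken line on the sphere is admissible if the vertices in each face are among the two end
  points of one of its edges: by extremality, it then meets the face in nothing, in a vertex or in
  that edge.
\<close>

lemma joined_within_polygonal_path:
  fixes A :: "real ^ 'n"
  assumes vertices: "set (A # vs) \<subseteq> sup_sphere"
    and edges: "\<And>P Q. (P, Q) \<in> set (zip (A # vs) vs) \<Longrightarrow> \<exists>F\<in>sphere_faces. P \<in> F \<and> Q \<in> F"
    and faces: "\<And>F. F \<in> sphere_faces \<Longrightarrow>
      \<exists>P Q. (P, Q) \<in> set (zip (A # vs) vs) \<and> set (A # vs) \<inter> F \<subseteq> {P, Q}"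
    and length: "(\<Sum>(P, Q)\<leftarrow>zip (A # vs) vs. infnorm (Q - P)) \<le> l"
  shows "joined_within A (last (A # vs)) l"
proof -
  let ?g = "polygonal_path A vs" and ?E = "set (zip (A # vs) vs)" and ?V = "set (A # vs)"
  have E_V: "P \<in> ?V \<and> Q \<in> ?V" if "(P, Q) \<in> ?E" for P Q
    using set_zip_leftD[OF that] set_zip_rightD[OF that] by simp
  have seg_face: "closed_segment P Q \<subseteq> F" if "F \<in> sphere_faces" "P \<in> F" "Q \<in> F" for P Q :: "real ^ 'n" and F
    using that by (intro closed_segment_subset convex_face)
  have meet: "\<exists>P\<in>?V \<inter> F. \<exists>Q\<in>?V \<inter> F. X \<in> closed_segment P Q"
    if F: "F \<in> sphere_faces" and X: "X \<in> path_image ?g" "X \<in> F" for F X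
  proof (cases "X \<in> ?V")
    case True
    then show ?thesis using X(2) by (intro bexI[of _ X]) auto
  next
    case False
    moreover have "last (A # vs) \<in> ?V" by (rule last_in_set) simp
    ultimately obtain P Q where PQ: "(P, Q) \<in> ?E" "X \<in> closed_segment P Q"
      using X(1) unfolding path_image_polygonal_path by auto
    then have "X \<in> open_segment P Q" using False E_V[OF PQ(1)] by (auto simp: open_segment_def)
    then have "P \<in> F \<and> Q \<in> F" using face_extreme[OF F] E_V[OF PQ(1)] vertices X(2) by blast
    then show ?thesis using PQ E_V by blast
  qed
  have "admissible_path A (last (A # vs)) ?g"
    unfolding admissible_path_def
  proof (intro conjI ballI impI)
    show "path_image ?g \<subseteq> sup_sphere"
    proof
      fix X assume "X \<in> path_image ?g"
      then consider "X = last (A # vs)" | P Q where "(P, Q) \<in> ?E" "X \<in> closed_segment P Q"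
        unfolding path_image_polygonal_path by auto
      then show "X \<in> sup_sphere"
      proof cases
        case 1
        moreover have "last (A # vs) \<in> ?V" by (rule last_in_set) simp
        ultimately show ?thesis using vertices by blast
      next
        case 2
        then show ?thesis using edges[OF 2(1)] seg_face Union_sphere_faces by blast
      qed
    qed
    fix F :: "(real ^ 'n) set"
    assume F: "F \<in> sphere_faces" "path_image ?g \<inter> F \<noteq> {}"
    obtain P Q where PQ: "(P, Q) \<in> ?E" "?V \<inter> F \<subseteq> {P, Q}" using faces[OF F(1)] by blast
    have PQ_image: "closed_segment P Q \<subseteq> path_image ?g"
      using PQ(1) unfolding path_image_polygonal_path by auto
    obtain R S where RS: "?V \<inter> F = {R, S}" "R \<in> {P, Q}" "S \<in> {P, Q}"
    proof -
      have "?V \<inter> F \<noteq> {}" using F(2) meet[OF F(1)] by blast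
      then have "?V \<inter> F = {P, P} \<or> ?V \<inter> F = {Q, Q} \<or> ?V \<inter> F = {P, Q}" using PQ(2) by blast
      then show thesis using that by blast
    qed
    have "path_image ?g \<inter> F = closed_segment R S"
    proof
      show "path_image ?g \<inter> F \<subseteq> closed_segment R S"
      proof
        fix X assume "X \<in> path_image ?g \<inter> F"
        then obtain T U where "T \<in> {R, S}" "U \<in> {R, S}" "X \<in> closed_segment T U"
          using meet[OF F(1)] unfolding RS(1) by blast
        then show "X \<in> closed_segment R S"
          using subset_closed_segment[of T U R S] by auto
      qed
      have "closed_segment R S \<subseteq> closed_segment P Q"
        using RS(2,3) by (auto simp: subset_closed_segment)
      moreover have "R \<in> F" "S \<in> F" using RS(1) by auto
      ultimately show "closed_segment R S \<subseteq> path_image ?g \<inter> F"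
        using PQ_image seg_face[OF F(1)] by blast
    qed
    then show "\<exists>P Q. path_image ?g \<inter> F = closed_segment P Q" by blast
  qed (simp_all add: path_polygonal_path)
  moreover have "sup_arc_length ?g \<le> ereal l"
    using sup_arc_length_le[OF length_controlled_polygonal_path[of A vs]] length
    by (auto intro: order_trans)
  ultimately show ?thesis unfolding joined_within_def by blast
qed

section \<open>Shortest routes across one and two side faces\<close>

text \<open>
  The route across the face \<open>y = 1\<close> has the vertices \<open>(1, 1, b)\<close> and \<open>(- 1, 1, d)\<close>. The excluded
  configurations are those in which the route meets another side face in two separate points or in
  a proper broken line.
\<close>

lemma joined_within_one_face:
  fixes a b c d :: real
  assumes bounds: "\<bar>a\<bar> \<le> 1" "\<bar>b\<bar> \<le> 1" "\<bar>c\<bar> \<le> 1" "\<bar>d\<bar> \<le> 1"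
    and not_opposite: "\<not> (a = - 1 \<and> c = - 1)"
    and not_top: "\<not> (b = 1 \<and> d = 1 \<and> a + c < 2)" and not_bottom: "\<not> (b = - 1 \<and> d = - 1 \<and> a + c < 2)"
  shows "joined_within (vector [1, a, b] :: real ^ 3) (vector [- 1, c, d]) (4 - a - c)"
proof -
  let ?A = "vector [1, a, b] :: real ^ 3" and ?P = "vector [1, 1, b] :: real ^ 3"
    and ?Q = "vector [- 1, 1, d] :: real ^ 3" and ?B = "vector [- 1, c, d] :: real ^ 3"
  have sphere: "set [?A, ?P, ?Q, ?B] \<subseteq> sup_sphere"
    using bounds by (simp add: sup_sphere_3)
  have "joined_within ?A (last [?A, ?P, ?Q, ?B]) (4 - a - c)"
  proof (rule joined_within_polygonal_path)
    fix U V assume "(U, V) \<in> set (zip [?A, ?P, ?Q, ?B] [?P, ?Q, ?B])"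
    then consider "U = ?A" "V = ?P" | "U = ?P" "V = ?Q" | "U = ?Q" "V = ?B" by auto
    then show "\<exists>F\<in>sphere_faces. U \<in> F \<and> V \<in> F"
    proof cases
      case 1
      then show ?thesis using sphere by (intro common_face_3I[of _ _ 1 1]) auto
    next
      case 2
      then show ?thesis using sphere by (intro common_face_3I[of _ _ 2 1]) auto
    next
      case 3
      then show ?thesis using sphere by (intro common_face_3I[of _ _ 1 "- 1"]) auto
    qed
  next
    fix F :: "(real ^ 3) set"
    assume "F \<in> sphere_faces"
    then have "set [?A, ?P, ?Q, ?B] \<inter> F \<subseteq> {?A, ?P} \<or> set [?A, ?P, ?Q, ?B] \<inter> F \<subseteq> {?P, ?Q} \<or>
        set [?A, ?P, ?Q, ?B] \<inter> F \<subseteq> {?Q, ?B}"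
    proof (cases rule: face_3_cases)
      case 4
      then show ?thesis using not_opposite by (auto simp: vector_3_eq_iff)
    next
      case 5
      then show ?thesis using not_top bounds by (auto simp: vector_3_eq_iff)
    next
      case 6
      then show ?thesis using not_bottom bounds by (auto simp: vector_3_eq_iff)
    qed (auto simp: vector_3_eq_iff)
    then show "\<exists>U V. (U, V) \<in> set (zip [?A, ?P, ?Q, ?B] [?P, ?Q, ?B]) \<and>
        set [?A, ?P, ?Q, ?B] \<inter> F \<subseteq> {U, V}"
      by (elim disjE) (rule exI, rule exI, rule conjI[rotated], assumption, simp)+
  next
    show "(\<Sum>(U, V)\<leftarrow>zip [?A, ?P, ?Q, ?B] [?P, ?Q, ?B]. infnorm (V - U)) \<le> 4 - a - c"
      using bounds by (simp add: infnorm_vector_diff)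
  qed (use sphere in auto)
  then show ?thesis by simp
qed

text \<open>
  The route through \<open>x = 1\<close>, \<open>z = - 1\<close>, \<open>y = 1\<close>, \<open>x = - 1\<close>, laid out in one plane, is a straight line
  from \<open>(a, b)\<close> to \<open>(2 + d, c - 4)\<close> with displacement \<open>(W, - H)\<close>; the parameters
  \<open>\<mu>\<^sub>1, \<dots>, \<mu>\<^sub>4\<close> are the fractions of the line that lie in the four faces. Since its pieces are parallel, their sup norms add up to \<open>max W H\<close>. If an end point
  already lies in \<open>z = - 1\<close> or \<open>y = 1\<close>, or if the line passes through one of the points \<open>(1, 1, - 1)\<close>
  and \<open>(- 1, 1, - 1)\<close>, then some of the fractions vanish and neighbouring vertices of the broken line
  coincide, which keeps it admissible. Excluded are the cases where both end points lie in \<open>y = - 1\<close>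
  or both lie in \<open>z = 1\<close>, because the path would meet this face in two separate pieces.
\<close>

lemma joined_within_two_faces_line:
  fixes a b c d :: real
  assumes bounds: "\<bar>a\<bar> \<le> 1" "\<bar>b\<bar> \<le> 1" "\<bar>c\<bar> \<le> 1" "\<bar>d\<bar> \<le> 1"
    and pos: "0 < W" "0 < H" "0 \<le> \<mu>\<^sub>1" "0 \<le> \<mu>\<^sub>2" "0 \<le> \<mu>\<^sub>3" "0 \<le> \<mu>\<^sub>4"
    and sum: "\<mu>\<^sub>1 + \<mu>\<^sub>2 + \<mu>\<^sub>3 + \<mu>\<^sub>4 = 1"
    and a: "a = 1 - (\<mu>\<^sub>1 + \<mu>\<^sub>2) * W" and b: "b = - 1 + \<mu>\<^sub>1 * H"
    and c: "c = 1 - \<mu>\<^sub>4 * H" and d: "d = - 1 + (\<mu>\<^sub>3 + \<mu>\<^sub>4) * W"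
    and H: "(\<mu>\<^sub>2 + \<mu>\<^sub>3) * H = 2"
    and left: "\<not> (a = - 1 \<and> c = - 1)" and top: "\<not> (b = 1 \<and> d = 1)"
  shows "joined_within (vector [1, a, b] :: real ^ 3) (vector [- 1, c, d]) (max W H)"
proof -
  define p where "p = 1 - \<mu>\<^sub>2 * W"
  define q where "q = 1 - \<mu>\<^sub>2 * H"
  define r where "r = - 1 + \<mu>\<^sub>3 * W"
  have prods: "0 \<le> \<mu>\<^sub>1 * W" "0 \<le> \<mu>\<^sub>2 * W" "0 \<le> \<mu>\<^sub>3 * W" "0 \<le> \<mu>\<^sub>4 * W"
    "0 \<le> \<mu>\<^sub>2 * H" "0 \<le> \<mu>\<^sub>3 * H" "0 \<le> \<mu>\<^sub>1 * H" "0 \<le> \<mu>\<^sub>4 * H"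
    using pos by simp_all
  have a': "a = p - \<mu>\<^sub>1 * W" and d': "d = r + \<mu>\<^sub>4 * W" and q': "q = - 1 + \<mu>\<^sub>3 * H"
    using a d H by (simp_all add: p_def q_def r_def algebra_simps)
  have pqr: "a \<le> p" "p \<le> 1" "- 1 \<le> q" "q \<le> 1" "- 1 \<le> r" "r \<le> d"
    using a' d' q' prods by (simp_all add: p_def q_def r_def)
  have "\<bar>p\<bar> \<le> 1" "\<bar>q\<bar> \<le> 1" "\<bar>r\<bar> \<le> 1" using bounds pqr by linarith+
  have A_edge: "a = p" if "b = - 1" using that b pos(2) a' by simp
  have B_edge: "d = r" if "c = 1" using that c pos(2) d' by simp
  have edge2: "q = 1 \<longleftrightarrow> p = 1" using pos by (simp add: p_def q_def)
  have edge3: "q = - 1 \<longleftrightarrow> r = - 1" using pos by (simp add: q' r_def)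
  have A_corner: "b = - 1" if "a = 1"
  proof -
    have "\<mu>\<^sub>1 * W = 0" using that a' pqr prods by linarith
    then show ?thesis using b pos by simp
  qed
  have B_corner: "c = 1" if "d = - 1"
  proof -
    have "\<mu>\<^sub>4 * W = 0" using that d' pqr prods by linarith
    then show ?thesis using c pos by simp
  qed
  let ?A = "vector [1, a, b] :: real ^ 3" and ?P = "vector [1, p, - 1] :: real ^ 3"
    and ?Q = "vector [q, 1, - 1] :: real ^ 3" and ?R = "vector [- 1, 1, r] :: real ^ 3"
    and ?B = "vector [- 1, c, d] :: real ^ 3"
  let ?vs = "[?P, ?Q, ?R, ?B]"
  have sphere: "set (?A # ?vs) \<subseteq> sup_sphere"
    using bounds \<open>\<bar>p\<bar> \<le> 1\<close> \<open>\<bar>q\<bar> \<le> 1\<close> \<open>\<bar>r\<bar> \<le> 1\<close> by (simp add: sup_sphere_3)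
  have "joined_within ?A (last (?A # ?vs)) (max W H)"
  proof (rule joined_within_polygonal_path)
    fix U V assume "(U, V) \<in> set (zip (?A # ?vs) ?vs)"
    then consider "U = ?A" "V = ?P" | "U = ?P" "V = ?Q" | "U = ?Q" "V = ?R" | "U = ?R" "V = ?B"
      by auto
    then show "\<exists>F\<in>sphere_faces. U \<in> F \<and> V \<in> F"
    proof cases
      case 1
      then show ?thesis using sphere by (intro common_face_3I[of _ _ 1 1]) auto
    next
      case 2
      then show ?thesis using sphere by (intro common_face_3I[of _ _ 3 "- 1"]) auto
    next
      case 3
      then show ?thesis using sphere by (intro common_face_3I[of _ _ 2 1]) auto
    next
      case 4
      then show ?thesis using sphere by (intro common_face_3I[of _ _ 1 "- 1"]) auto
    qed
  next
    fix F :: "(real ^ 3) set"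
    assume "F \<in> sphere_faces"
    then have "set (?A # ?vs) \<inter> F \<subseteq> {?A, ?P} \<or> set (?A # ?vs) \<inter> F \<subseteq> {?P, ?Q} \<or>
        set (?A # ?vs) \<inter> F \<subseteq> {?Q, ?R} \<or> set (?A # ?vs) \<inter> F \<subseteq> {?R, ?B}"
    proof (cases rule: face_3_cases)
      case 1
      have "set (?A # ?vs) \<inter> F \<subseteq> {?A, ?P}"
        using edge2 unfolding 1 by (auto simp: vector_3_eq_iff)
      then show ?thesis by simp
    next
      case 2
      have "set (?A # ?vs) \<inter> F \<subseteq> {?R, ?B}"
        using edge3 unfolding 2 by (auto simp: vector_3_eq_iff)
      then show ?thesis by simp
    next
      case 3
      have "set (?A # ?vs) \<inter> F \<subseteq> {?Q, ?R}"
        using edge2 A_corner A_edge B_edge unfolding 3 by (auto simp: vector_3_eq_iff)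
      then show ?thesis by simp
    next
      case 4
      show ?thesis
      proof (cases "a = - 1")
        case True
        then have "set (?A # ?vs) \<inter> F \<subseteq> {?A, ?P}"
          using left unfolding 4 by (auto simp: vector_3_eq_iff)
        then show ?thesis by simp
      next
        case False
        then have "p \<noteq> - 1" using pqr(1) bounds(1) by auto
        with False have "set (?A # ?vs) \<inter> F \<subseteq> {?R, ?B}"
          unfolding 4 by (auto simp: vector_3_eq_iff)
        then show ?thesis by simp
      qed
    next
      case 5
      show ?thesis
      proof (cases "d = 1")
        case True
        then have "set (?A # ?vs) \<inter> F \<subseteq> {?R, ?B}"
          using top unfolding 5 by (auto simp: vector_3_eq_iff)
        then show ?thesis by simp
      next
        case False
        then have "r \<noteq> 1" using pqr(6) bounds(4) by auto
        with False have "set (?A # ?vs) \<inter> F \<subseteq> {?A, ?P}"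
          unfolding 5 by (auto simp: vector_3_eq_iff)
        then show ?thesis by simp
      qed
    next
      case 6
      have "set (?A # ?vs) \<inter> F \<subseteq> {?P, ?Q}"
        using edge3 B_corner A_edge B_edge unfolding 6 by (auto simp: vector_3_eq_iff)
      then show ?thesis by simp
    qed
    then show "\<exists>U V. (U, V) \<in> set (zip (?A # ?vs) ?vs) \<and> set (?A # ?vs) \<inter> F \<subseteq> {U, V}"
      by (elim disjE) (rule exI, rule exI, rule conjI[rotated], assumption, simp)+
  next
    have scale: "max (x * W) (x * H) = x * max W H" "max (x * H) (x * W) = x * max W H" if "0 \<le> x" for x
      using that by (simp_all add: max_mult_distrib_left max.commute)
    have "0 \<le> \<mu>\<^sub>1 * max W H" "0 \<le> \<mu>\<^sub>4 * max W H"
      using pos by (simp_all add: le_max_iff_disj)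
    note simps = infnorm_vector_diff scale max_absorb1 max_absorb2
    have "infnorm (?P - ?A) = \<mu>\<^sub>1 * max W H"
      using prods pos \<open>0 \<le> \<mu>\<^sub>1 * max W H\<close> by (simp add: simps a' b)
    moreover have "infnorm (?Q - ?P) = \<mu>\<^sub>2 * max W H"
      using prods pos by (simp add: simps p_def q_def)
    moreover have "infnorm (?R - ?Q) = \<mu>\<^sub>3 * max W H"
      using prods pos by (simp add: simps q' r_def)
    moreover have "infnorm (?B - ?R) = \<mu>\<^sub>4 * max W H"
      using prods pos \<open>0 \<le> \<mu>\<^sub>4 * max W H\<close> by (simp add: simps c d')
    moreover have "\<mu>\<^sub>1 * max W H + \<mu>\<^sub>2 * max W H + \<mu>\<^sub>3 * max W H + \<mu>\<^sub>4 * max W H = max W H"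
      using sum by (simp flip: distrib_right)
    ultimately show "(\<Sum>(U, V)\<leftarrow>zip (?A # ?vs) ?vs. infnorm (V - U)) \<le> max W H"
      by simp
  qed (use sphere in auto)
  then show ?thesis by simp
qed

text \<open>
  The inequalities \<open>a + b \<le> 0\<close> and \<open>c + d \<ge> 0\<close> make the straight line of the unfolding cross the four
  faces in the right order. They are equivalent to this route being at least as short, in the
  \<open>H\<close>-component, as those across \<open>y = 1\<close> and across \<open>z = - 1\<close> alone.
\<close>

lemma joined_within_two_faces:
  fixes a b c d :: real
  assumes bounds: "\<bar>a\<bar> \<le> 1" "\<bar>b\<bar> \<le> 1" "\<bar>c\<bar> \<le> 1" "\<bar>d\<bar> \<le> 1"
    and ab: "a + b \<le> 0" and cd: "0 \<le> c + d"
    and left: "\<not> (a = - 1 \<and> c = - 1)" and top: "\<not> (b = 1 \<and> d = 1)"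
  shows "joined_within (vector [1, a, b] :: real ^ 3) (vector [- 1, c, d])
           (max (2 - a + d) (4 + b - c))"
proof (cases "2 - a + d = 0")
  case True
  \<comment> \<open>Then the points are opposite ends of an edge, and the line of the unfolding has no horizontal
    extent; the route across one face is equally short.\<close>
  then have "a = 1" "d = - 1" using bounds by linarith+
  moreover from this have "b = - 1" "c = 1" using bounds ab cd by linarith+
  ultimately show ?thesis using joined_within_one_face[of a b c d] by simp
next
  case False
  define W where "W = 2 - a + d"
  define H where "H = 4 + b - c"
  have W: "0 < W" and H: "0 < H" using False bounds by (auto simp: W_def H_def)
  \<comment> \<open>The difference of the two sides of the next inequality is
    \<open>(1 - d) * (1 + b) + (1 - c) * (1 - a) - 2 * (a + b)\<close>; it says that the line leaves \<open>x = 1\<close>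
    before it reaches \<open>y = 1\<close>.\<close>
  have "0 \<le> (1 - d) * (1 + b)" "0 \<le> (1 - c) * (1 - a)"
    using bounds by (intro mult_nonneg_nonneg; linarith)+
  then have 2: "(1 + b) * W \<le> (1 - a) * H"
    using ab by (simp add: W_def H_def algebra_simps)
  \<comment> \<open>Likewise with \<open>(1 + a) * (1 - c) + (1 + b) * (1 + d) + 2 * (c + d)\<close>: the line leaves \<open>z = - 1\<close>
    before it reaches \<open>x = - 1\<close>.\<close>
  have "0 \<le> (1 + a) * (1 - c)" "0 \<le> (1 + b) * (1 + d)"
    using bounds by (intro mult_nonneg_nonneg; linarith)+
  then have 3: "(1 - a) * H \<le> (3 + b) * W"
    using cd by (simp add: W_def H_def algebra_simps)
  have "joined_within (vector [1, a, b] :: real ^ 3) (vector [- 1, c, d]) (max W H)"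
  proof (rule joined_within_two_faces_line[OF bounds W H _ _ _ _ _ _ _ _ _ _ left top, where
        \<mu>\<^sub>1 = "(1 + b) / H" and \<mu>\<^sub>2 = "(1 - a) / W - (1 + b) / H" and
        \<mu>\<^sub>3 = "(3 + b) / H - (1 - a) / W" and \<mu>\<^sub>4 = "(1 - c) / H"])
    show "0 \<le> (1 + b) / H" "0 \<le> (1 - c) / H" using bounds H by auto
    show "0 \<le> (1 - a) / W - (1 + b) / H" using 2 W H by (simp add: field_simps)
    show "0 \<le> (3 + b) / H - (1 - a) / W" using 3 W H by (simp add: field_simps)
    have "(1 + b) / H + ((1 - a) / W - (1 + b) / H) + ((3 + b) / H - (1 - a) / W) + (1 - c) / H
        = ((3 + b) + (1 - c)) / H"
      by (simp add: add_divide_distrib diff_divide_distrib)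
    also have "\<dots> = 1" using H by (simp add: H_def)
    finally show "(1 + b) / H + ((1 - a) / W - (1 + b) / H) + ((3 + b) / H - (1 - a) / W) + (1 - c) / H
        = 1" .
    have "(3 + b) / H - (1 - a) / W + (1 - c) / H = ((3 + b) + (1 - c)) / H - (1 - a) / W"
      by (simp add: add_divide_distrib diff_divide_distrib)
    also have "\<dots> = 1 - (1 - a) / W" using H by (simp add: H_def)
    finally have "((3 + b) / H - (1 - a) / W + (1 - c) / H) * W = (1 - (1 - a) / W) * W"
      by (rule arg_cong)
    also have "\<dots> = W - (1 - a)" using W by (simp add: field_simps)
    finally show "d = - 1 + ((3 + b) / H - (1 - a) / W + (1 - c) / H) * W"
      by (simp add: W_def)
    show "((1 - a) / W - (1 + b) / H + ((3 + b) / H - (1 - a) / W)) * H = 2"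
      using H by (simp add: field_simps)
  qed (use W H in simp_all)
  then show ?thesis by (simp add: W_def H_def)
qed

section \<open>The geodesic distance between opposite faces\<close>

lemma opposite_dist_le_one_face:
  "opposite_dist a b c d \<le> 4 - a - c" "opposite_dist a b c d \<le> 4 + a + c"
  "opposite_dist a b c d \<le> 4 - b - d" "opposite_dist a b c d \<le> 4 + b + d"
proof -
  have route: "opposite_route a b c d \<le> 4 - a - c" for a b c d
    unfolding opposite_route_def by (rule min.cobounded1)
  have "opposite_dist a b c d \<le> opposite_route a b c d"
    and "opposite_dist a b c d \<le> opposite_route (- a) b (- c) d"
    and "opposite_dist a b c d \<le> opposite_route b a d c"
    and "opposite_dist a b c d \<le> opposite_route (- b) a (- d) c"
    unfolding opposite_dist_def by (simp_all only: min.coboundedI1 min.coboundedI2 order_refl)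
  with route[of a b c d] route[of "- a" b "- c" d] route[of b a d c] route[of "- b" a "- d" c]
  show "opposite_dist a b c d \<le> 4 - a - c" "opposite_dist a b c d \<le> 4 + a + c"
    "opposite_dist a b c d \<le> 4 - b - d" "opposite_dist a b c d \<le> 4 + b + d"
    by linarith+
qed

text \<open>
  If the overall minimum is attained by a route that enters \<open>x = - 1\<close> from \<open>y = 1\<close>, then comparing it
  with the four routes across a single side face yields all the inequalities that make its
  construction possible.
\<close>

lemma joined_within_opposite_route:
  fixes a b c d :: real
  assumes bounds: "\<bar>a\<bar> \<le> 1" "\<bar>b\<bar> \<le> 1" "\<bar>c\<bar> \<le> 1" "\<bar>d\<bar> \<le> 1"
    and min: "opposite_dist a b c d = opposite_route a b c d"
  shows "joined_within (vector [1, a, b] :: real ^ 3) (vector [- 1, c, d]) (opposite_dist a b c d)"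
proof -
  let ?l = "opposite_dist a b c d"
  note le = opposite_dist_le_one_face[where a = a and b = b and c = c and d = d]
  have "?l = 4 - a - c \<or> ?l = max (2 - a - d) (4 - b - c) \<or> ?l = max (2 - a + d) (4 + b - c)"
    unfolding min opposite_route_def min_def by simp
  then consider "?l = 4 - a - c" | "?l = max (2 - a - d) (4 - b - c)" | "?l = max (2 - a + d) (4 + b - c)"
    by blast
  then show ?thesis
  proof cases
    case 1
    then have "0 \<le> a + c" "b + d \<le> a + c" "- (b + d) \<le> a + c" using le by linarith+
    then have "joined_within (vector [1, a, b] :: real ^ 3) (vector [- 1, c, d]) (4 - a - c)"
      using bounds by (intro joined_within_one_face) linarith+
    then show ?thesis using 1 by simp
  next
    case 2
    then have "4 - b - c \<le> ?l" by simp
    then have *: "a + - b \<le> 0" "0 \<le> c + - d" "- b \<le> a + 2 * c" "- 2 * b \<le> c + d"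
      using le by linarith+
    have "\<not> (a = - 1 \<and> c = - 1)" using *(3) bounds(2) by (intro notI) (elim conjE, linarith)
    moreover have "\<not> (- b = 1 \<and> - d = 1)" using *(4) bounds(3) by (intro notI) (elim conjE, linarith)
    moreover have "\<bar>- b\<bar> \<le> 1" "\<bar>- d\<bar> \<le> 1" using bounds by simp_all
    ultimately have "joined_within (vector [1, a, - b] :: real ^ 3) (vector [- 1, c, - d])
        (max (2 - a + - d) (4 + - b - c))"
      using * bounds by (intro joined_within_two_faces)
    from joined_within_swap[OF this]
    have "joined_within (vector [1, - b, a] :: real ^ 3) (vector [- 1, - d, c]) ?l"
      using 2 by simp
    from joined_within_swap[OF joined_within_reflect[OF this]] show ?thesis by simp
  next
    case 3
    then have "4 + b - c \<le> ?l" by simp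
    then have *: "a + b \<le> 0" "0 \<le> c + d" "b \<le> a + 2 * c" "2 * b + d \<le> c"
      using le by linarith+
    have "\<not> (a = - 1 \<and> c = - 1)" using *(3) bounds(2) by (intro notI) (elim conjE, linarith)
    moreover have "\<not> (b = 1 \<and> d = 1)" using *(4) bounds(3) by (intro notI) (elim conjE, linarith)
    ultimately have "joined_within (vector [1, a, b] :: real ^ 3) (vector [- 1, c, d])
        (max (2 - a + d) (4 + b - c))"
      using * bounds by (intro joined_within_two_faces)
    then show ?thesis using 3 by simp
  qed
qed

lemma joined_within_opposite_dist:
  fixes a b c d :: real
  assumes bounds: "\<bar>a\<bar> \<le> 1" "\<bar>b\<bar> \<le> 1" "\<bar>c\<bar> \<le> 1" "\<bar>d\<bar> \<le> 1"
  shows "joined_within (vector [1, a, b] :: real ^ 3) (vector [- 1, c, d]) (opposite_dist a b c d)"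
proof -
  let ?l = "opposite_dist a b c d"
  have l: "opposite_dist (- a) b (- c) d = ?l" "opposite_dist b a d c = ?l"
      "opposite_dist (- b) a (- d) c = ?l"
    using opposite_dist_reflect[of a b c d] opposite_dist_swap[of b a d c]
      opposite_dist_reflect[of b a d c] by simp_all
  consider "?l = opposite_route a b c d" | "?l = opposite_route (- a) b (- c) d"
    | "?l = opposite_route b a d c" | "?l = opposite_route (- b) a (- d) c"
  proof -
    have "?l = opposite_route a b c d \<or> ?l = opposite_route (- a) b (- c) d \<or>
        ?l = opposite_route b a d c \<or> ?l = opposite_route (- b) a (- d) c"
      unfolding opposite_dist_def by (metis min_def)
    then show thesis using that by blast
  qed
  then show ?thesis
  proof cases
    case 1
    then show ?thesis using bounds by (intro joined_within_opposite_route)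
  next
    case 2
    then have "joined_within (vector [1, - a, b] :: real ^ 3) (vector [- 1, - c, d]) ?l"
      using bounds joined_within_opposite_route[of "- a" b "- c" d] by (simp add: l)
    from joined_within_reflect[OF this] show ?thesis by simp
  next
    case 3
    then have "joined_within (vector [1, b, a] :: real ^ 3) (vector [- 1, d, c]) ?l"
      using bounds joined_within_opposite_route[of b a d c] by (simp add: l)
    from joined_within_swap[OF this] show ?thesis .
  next
    case 4
    then have "joined_within (vector [1, - b, a] :: real ^ 3) (vector [- 1, - d, c]) ?l"
      using bounds joined_within_opposite_route[of "- b" a "- d" c] by (simp add: l)
    from joined_within_swap[OF joined_within_reflect[OF this]] show ?thesis by simp
  qed
qed

lemma opposite_dist_le_sup_arc_length:
  fixes a b c d :: real and g :: "real \<Rightarrow> real ^ 3"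
  assumes bounds: "\<bar>a\<bar> \<le> 1" "\<bar>b\<bar> \<le> 1"
    and g: "path g" "path_image g \<subseteq> sup_sphere"
    and ends: "pathstart g = (vector [1, a, b] :: real ^ 3)" "pathfinish g = vector [- 1, c, d]"
  shows "ereal (opposite_dist a b c d) \<le> sup_arc_length g"
  using potential_le_sup_arc_length[OF g, of "unfolded_dist a b"]
    unfolded_dist_lipschitz_on_face[OF bounds]
  by (simp add: ends unfolded_dist_def)

lemma has_geodesic_distance_opposite_dist:
  fixes a b c d :: real
  assumes bounds: "\<bar>a\<bar> \<le> 1" "\<bar>b\<bar> \<le> 1" "\<bar>c\<bar> \<le> 1" "\<bar>d\<bar> \<le> 1"
  shows "has_geodesic_distance (vector [1, a, b] :: real ^ 3) (vector [- 1, c, d])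
           (opposite_dist a b c d)"
proof -
  have lower: "ereal (opposite_dist a b c d) \<le> sup_arc_length g"
    if "admissible_path (vector [1, a, b]) (vector [- 1, c, d]) g"
    for g :: "real \<Rightarrow> real ^ 3"
    using that bounds unfolding admissible_path_def
    by (intro opposite_dist_le_sup_arc_length) auto
  obtain g :: "real \<Rightarrow> real ^ 3" where g: "admissible_path (vector [1, a, b]) (vector [- 1, c, d]) g"
      "sup_arc_length g \<le> ereal (opposite_dist a b c d)"
    using joined_within_opposite_dist[OF bounds] unfolding joined_within_def by blast
  then have "sup_arc_length g = ereal (opposite_dist a b c d)"
    by (intro antisym lower)
  with g(1) lower show ?thesis unfolding has_geodesic_distance_def by blast
qed

section \<open>When a given route is the shortest\<close>

lemma one_face_route_minimal_iff:
  fixes a b c d :: real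
  assumes "\<bar>a\<bar> \<le> 1" "\<bar>b\<bar> \<le> 1" "\<bar>c\<bar> \<le> 1" "\<bar>d\<bar> \<le> 1"
  shows "(4 - a - c \<le> 4 + a + c \<and> 4 - a - c \<le> 4 - b - d \<and> 4 - a - c \<le> 4 + b + d \<and>
      4 - a - c \<le> max (2 - a - d) (4 - b - c) \<and> 4 - a - c \<le> max (2 - a + d) (4 + b - c) \<and>
      4 - a - c \<le> max (2 + a - d) (4 - b + c) \<and> 4 - a - c \<le> max (2 + a + d) (4 + b + c) \<and>
      4 - a - c \<le> max (2 - b - c) (4 - a - d) \<and> 4 - a - c \<le> max (2 + b - c) (4 - a + d) \<and>
      4 - a - c \<le> max (2 - b + c) (4 + a - d) \<and> 4 - a - c \<le> max (2 + b + c) (4 + a + d)) \<longleftrightarrow>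
       (\<bar>b\<bar> \<le> a \<and> \<bar>d\<bar> \<le> c) \<or>
       (c = 1 \<and> - d = 1 \<and> b \<ge> - a) \<or>
       (c = 1 \<and> d = 1 \<and> b \<le> a) \<or>
       (a = 1 \<and> - b = 1 \<and> d \<ge> - c) \<or>
       (a = 1 \<and> b = 1 \<and> d \<le> c)"
  using assms by (smt (verit))

lemma two_face_route_minimal_iff:
  fixes a b c d :: real
  assumes "\<bar>a\<bar> \<le> 1" "\<bar>b\<bar> \<le> 1" "\<bar>c\<bar> \<le> 1" "\<bar>d\<bar> \<le> 1"
  defines "m \<equiv> max (2 - a + d) (4 + b - c)"
  shows "(m \<le> 4 - a - c \<and> m \<le> 4 + a + c \<and> m \<le> 4 - b - d \<and> m \<le> 4 + b + d \<and>
      m \<le> max (2 - a - d) (4 - b - c) \<and>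
      m \<le> max (2 + a - d) (4 - b + c) \<and> m \<le> max (2 + a + d) (4 + b + c) \<and>
      m \<le> max (2 - b - c) (4 - a - d) \<and> m \<le> max (2 + b - c) (4 - a + d) \<and>
      m \<le> max (2 - b + c) (4 + a - d) \<and> m \<le> max (2 + b + c) (4 + a + d)) \<longleftrightarrow>
       (a + b \<le> 0 \<and> c + d \<ge> 0 \<and> \<bar>a + d\<bar> \<le> c - b \<and> b + d \<le> a + c \<and> b \<le> 0 \<and> c \<ge> 0) \<or>
       (b = - 1 \<and> c \<ge> 0 \<and> - c \<le> d \<and> d \<le> 1 + a + c) \<or>
       (b = - 1 \<and> d \<ge> 1 - a - c) \<or>
       (c = 1 \<and> b \<le> 0 \<and> b + d - 1 \<le> a \<and> a \<le> - b) \<or>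
       (c = 1 \<and> a \<le> - 1 - b - d)"
  using assms unfolding m_def by (smt (verit))

theorem theorem2:
  fixes a b c d :: real and A B :: "real ^ 3" and s :: "nat \<Rightarrow> real"
  assumes "A = vector [1, a, b]" and "A \<in> sup_sphere"
    and "B = vector [- 1, c, d]" and "B \<in> sup_sphere"
    and "s 1 = 4 - a - c"
    and "s 2 = 4 + a + c"
    and "s 3 = 4 - b - d"
    and "s 4 = 4 + b + d"
    and "s 5 = max (2 - a - d) (4 - b - c)"
    and "s 6 = max (2 - a + d) (4 + b - c)"
    and "s 7 = max (2 + a - d) (4 - b + c)"
    and "s 8 = max (2 + a + d) (4 + b + c)"
    and "s 9 = max (2 - b - c) (4 - a - d)"
    and "s 10 = max (2 + b - c) (4 - a + d)"
    and "s 11 = max (2 - b + c) (4 + a - d)"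
    and "s 12 = max (2 + b + c) (4 + a + d)"
  shows "has_geodesic_distance A B (Min (s ` {1..12})) \<and>
    (Min (s ` {1..12}) = s 1 \<longleftrightarrow>
       (\<bar>b\<bar> \<le> a \<and> \<bar>d\<bar> \<le> c) \<or>
       (c = 1 \<and> - d = 1 \<and> b \<ge> - a) \<or>
       (c = 1 \<and> d = 1 \<and> b \<le> a) \<or>
       (a = 1 \<and> - b = 1 \<and> d \<ge> - c) \<or>
       (a = 1 \<and> b = 1 \<and> d \<le> c)) \<and>
    (Min (s ` {1..12}) = s 6 \<longleftrightarrow>
       (a + b \<le> 0 \<and> c + d \<ge> 0 \<and> \<bar>a + d\<bar> \<le> c - b \<and> b + d \<le> a + c \<and> b \<le> 0 \<and> c \<ge> 0) \<or>
       (b = - 1 \<and> c \<ge> 0 \<and> - c \<le> d \<and> d \<le> 1 + a + c) \<or>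
       (b = - 1 \<and> d \<ge> 1 - a - c) \<or>
       (c = 1 \<and> b \<le> 0 \<and> b + d - 1 \<le> a \<and> a \<le> - b) \<or>
       (c = 1 \<and> a \<le> - 1 - b - d))"
proof (intro conjI)
  note s = assms(5-)
  have bounds: "\<bar>a\<bar> \<le> 1" "\<bar>b\<bar> \<le> 1" "\<bar>c\<bar> \<le> 1" "\<bar>d\<bar> \<le> 1"
    using assms(1-4) by (simp_all add: sup_sphere_3)
  have indices: "{1..12::nat} = {1, 2, 3, 4, 5, 6, 7, 8, 9, 10, 11, 12}" by (auto, presburger)
  have "Min (s ` {1..12}) =
      min (min (min (s 1) (min (s 5) (s 6))) (min (s 2) (min (s 7) (s 8))))
        (min (min (s 3) (min (s 9) (s 11))) (min (s 4) (min (s 10) (s 12))))"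
  proof -
    have "{1..12::nat} = {1, 5, 6, 2, 7, 8, 3, 9, 11, 4, 10, 12}" unfolding indices by blast
    then have "Min (s ` {1..12}) = Min {s 1, s 5, s 6, s 2, s 7, s 8, s 3, s 9, s 11, s 4, s 10, s 12}"
      by (simp only: image_insert image_empty)
    then show ?thesis
      by (simp only: Min_insert Min_singleton finite.intros insert_not_empty not_False_eq_True min.assoc)
  qed
  also have "\<dots> = opposite_dist a b c d"
    unfolding s opposite_dist_def opposite_route_def by (simp only: diff_minus_eq_add)
  finally show "has_geodesic_distance A B (Min (s ` {1..12}))"
    using has_geodesic_distance_opposite_dist[OF bounds] assms(1,3) by simp
  have min_iff: "Min (s ` {1..12}) = s k \<longleftrightarrow> (\<forall>i\<in>{1..12}. s k \<le> s i)" if "k \<in> {1..12}" for k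
    using that by (subst Min_eq_iff) auto
  have "Min (s ` {1..12}) = s 1 \<longleftrightarrow> s 1 \<le> s 2 \<and> s 1 \<le> s 3 \<and> s 1 \<le> s 4 \<and> s 1 \<le> s 5 \<and>
      s 1 \<le> s 6 \<and> s 1 \<le> s 7 \<and> s 1 \<le> s 8 \<and> s 1 \<le> s 9 \<and> s 1 \<le> s 10 \<and> s 1 \<le> s 11 \<and> s 1 \<le> s 12"
    by (subst min_iff) (simp_all add: indices del: One_nat_def)
  then show "Min (s ` {1..12}) = s 1 \<longleftrightarrow>
       (\<bar>b\<bar> \<le> a \<and> \<bar>d\<bar> \<le> c) \<or>
       (c = 1 \<and> - d = 1 \<and> b \<ge> - a) \<or>
       (c = 1 \<and> d = 1 \<and> b \<le> a) \<or>
       (a = 1 \<and> - b = 1 \<and> d \<ge> - c) \<or>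
       (a = 1 \<and> b = 1 \<and> d \<le> c)"
    unfolding s one_face_route_minimal_iff[OF bounds] .
  have "Min (s ` {1..12}) = s 6 \<longleftrightarrow> s 6 \<le> s 1 \<and> s 6 \<le> s 2 \<and> s 6 \<le> s 3 \<and> s 6 \<le> s 4 \<and>
      s 6 \<le> s 5 \<and> s 6 \<le> s 7 \<and> s 6 \<le> s 8 \<and> s 6 \<le> s 9 \<and> s 6 \<le> s 10 \<and> s 6 \<le> s 11 \<and> s 6 \<le> s 12"
    by (subst min_iff) (simp_all add: indices del: One_nat_def)
  then show "Min (s ` {1..12}) = s 6 \<longleftrightarrow>
       (a + b \<le> 0 \<and> c + d \<ge> 0 \<and> \<bar>a + d\<bar> \<le> c - b \<and> b + d \<le> a + c \<and> b \<le> 0 \<and> c \<ge> 0) \<or>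
       (b = - 1 \<and> c \<ge> 0 \<and> - c \<le> d \<and> d \<le> 1 + a + c) \<or>
       (b = - 1 \<and> d \<ge> 1 - a - c) \<or>
       (c = 1 \<and> b \<le> 0 \<and> b + d - 1 \<le> a \<and> a \<le> - b) \<or>
       (c = 1 \<and> a \<le> - 1 - b - d)"
    unfolding s two_face_route_minimal_iff[OF bounds] .
qed

end
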